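(* Let $X=\{x_{1},\ldots,x_{l}\}$ and $Y=\{-y_{1},\ldots,-y_{m}\}$ be disjoint nonempty sets of even integers, where $x_{1}>\cdots>x_{l}$ are non-negative even integers and $y_{1}<\cdots<y_{m}$ are positive even integers, and suppose $X\cup Y\neq\{0\}$. Then $X\cup Y$ is the imbalance set of a tournament if any one of the following conditions holds: (i) $0\in X\cup Y$; (ii) for some non-negative integers $r,s$ there exist (not necessarily distinct) $x_{p_1},\ldots,x_{p_{2r+1}}\in X$ and (not necessarily distinct) $-y_{q_1},\ldots,-y_{q_{2s}}\in Y$ such that $\sum_{j=1}^{2r+1}x_{p_j}=\sum_{j=1}^{2s}y_{q_j}$; (iii) for some non-negative integers $r,s$ there exist (not necessarily distinct) $-y_{p_1},\ldots,-y_{p_{2r+1}}\in Y$ and (not necessarily distinct) $x_{q_1},\ldots,x_{q_{2s}}\in X$ such that $\sum_{j=1}^{2r+1}y_{p_j}=\sum_{j=1}^{2s}x_{q_j}$.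
   Context: A tournament is an orientation of a complete simple graph. The imbalance of a vertex $v$ in a digraph is $d^{+}(v)-d^{-}(v)$ (outdegree minus indegree), and the imbalance set of a digraph is the set of imbalances of its vertices.
   Formalization: The case X = {0} is excluded by an added hypothesis: there the claim always fails, e.g. X = {0}, Y = {-2} satisfies (i), but the imbalances of a tournament sum to 0, so {0,-2} is not an imbalance set. *)

theory Defs
  imports "Graph_Theory.Kuratowski"
begin

text \<open>
  Undirected simple graphs are the symmetric loop-free digraphs of the digraph library, so that
  an edge of \<open>G\<close> is a pair of opposite arcs; an orientation keeps exactly one arc of each pair.
\<close>

definition orientation_of :: "'a pair_pre_digraph \<Rightarrow> 'a pair_pre_digraph \<Rightarrow> bool" where
  "orientation_of D G \<longleftrightarrow>
     pair_graph G \<and> pverts D = pverts G \<and> parcs D \<subseteq> parcs G \<and>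
     (\<forall>u v. (u, v) \<in> parcs G \<longrightarrow> ((u, v) \<in> parcs D \<longleftrightarrow> (v, u) \<notin> parcs D))"

definition tournament :: "'a pair_pre_digraph \<Rightarrow> bool" where
  "tournament D \<longleftrightarrow> (\<exists>n G. K\<^bsub>n\<^esub> (with_proj G) \<and> orientation_of D G)"

definition imbalance :: "('a, 'b) pre_digraph \<Rightarrow> 'a \<Rightarrow> int" where
  "imbalance D v = int (out_degree D v) - int (in_degree D v)"

definition imbalance_set :: "('a, 'b) pre_digraph \<Rightarrow> int set" where
  "imbalance_set D = imbalance D ` verts D"

lemma tournament_iff:
  "tournament D \<longleftrightarrow>
     finite (pverts D) \<and>
     parcs D \<subseteq> {(u, v). u \<in> pverts D \<and> v \<in> pverts D \<and> u \<noteq> v} \<and>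
     (\<forall>u \<in> pverts D. \<forall>v \<in> pverts D. u \<noteq> v \<longrightarrow> ((u, v) \<in> parcs D \<longleftrightarrow> (v, u) \<notin> parcs D))"
  (is "_ \<longleftrightarrow> ?fin \<and> ?sub \<and> ?one")
proof
  assume "tournament D"
  then obtain n G where K: "K\<^bsub>n\<^esub> (with_proj G)" and O: "orientation_of D G"
    unfolding tournament_def by blast
  have fin: "finite (pverts G)"
    and arcs: "\<And>u v. (u, v) \<in> parcs G \<longleftrightarrow> u \<in> pverts G \<and> v \<in> pverts G \<and> u \<noteq> v"
    using K by (simp_all add: complete_digraph_pair_def)
  have verts: "pverts D = pverts G" and sub: "parcs D \<subseteq> parcs G"
    and one: "\<And>u v. (u, v) \<in> parcs G \<Longrightarrow> (u, v) \<in> parcs D \<longleftrightarrow> (v, u) \<notin> parcs D"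
    using O unfolding orientation_of_def by blast+
  have ?sub
    unfolding verts using sub arcs by blast
  moreover have ?one
    unfolding verts using one arcs by blast
  ultimately show "?fin \<and> ?sub \<and> ?one"
    using fin verts by metis
next
  assume R: "?fin \<and> ?sub \<and> ?one"
  then have fin: ?fin and sub: ?sub and one: ?one
    by blast+
  define G where "G = \<lparr> pverts = pverts D,
    parcs = {(u, v). u \<in> pverts D \<and> v \<in> pverts D \<and> u \<noteq> v} \<rparr>"
  have K: "K\<^bsub>card (pverts D)\<^esub> (with_proj G)"
    unfolding complete_digraph_pair_def using fin by (simp add: G_def)
  have "finite (parcs G)"
    by (rule finite_subset[of _ "pverts D \<times> pverts D"]) (use fin in \<open>auto simp: G_def\<close>)
  then have "pair_graph G"
    using fin by unfold_locales (auto simp: G_def symmetric_def sym_def)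
  moreover have "parcs D \<subseteq> parcs G"
    using sub by (simp add: G_def)
  moreover have "\<forall>u v. (u, v) \<in> parcs G \<longrightarrow> ((u, v) \<in> parcs D \<longleftrightarrow> (v, u) \<notin> parcs D)"
    unfolding G_def pair_pre_digraph.simps using one by blast
  moreover have "pverts D = pverts G"
    by (simp add: G_def)
  ultimately have "orientation_of D G"
    unfolding orientation_of_def by blast
  with K show "tournament D"
    unfolding tournament_def by blast
qed

text \<open>
  The imbalances of a tournament sum to zero, so they cannot all be non-positive unless
  they all vanish. Hence \<open>{0} \<union> Y\<close> with \<open>Y\<close> a nonempty set of negative integers is never
  an imbalance set; this is why \<open>X = {0}\<close> has to be excluded in the theorem.
\<close>

lemma card_eq_sum_fibres:
  assumes "finite A" "finite B" "f ` A \<subseteq> B"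
  shows "card A = (\<Sum>b \<in> B. card {a \<in> A. f a = b})"
  using sum.group[OF assms, of "\<lambda>_. 1 :: nat"] by simp

lemma sum_imbalance_eq_0:
  assumes "tournament D"
  shows "(\<Sum>v \<in> pverts D. imbalance (with_proj D) v) = 0"
proof -
  have fin: "finite (pverts D)" and sub: "parcs D \<subseteq> pverts D \<times> pverts D"
    using assms unfolding tournament_iff by blast+
  have finA: "finite (parcs D)"
    using fin sub by (meson finite_SigmaI finite_subset)
  have "(\<Sum>v \<in> pverts D. card {e \<in> parcs D. fst e = v}) = card (parcs D)"
    using fin finA sub by (intro card_eq_sum_fibres[symmetric]) auto
  moreover have "(\<Sum>v \<in> pverts D. card {e \<in> parcs D. snd e = v}) = card (parcs D)"
    using fin finA sub by (intro card_eq_sum_fibres[symmetric]) auto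
  ultimately show ?thesis
    by (simp add: imbalance_def out_degree_def in_degree_def out_arcs_def in_arcs_def
        sum_subtractf flip: of_nat_sum)
qed

lemma imbalance_set_nonpos:
  assumes "tournament D" and "\<forall>b \<in> imbalance_set (with_proj D). b \<le> 0"
  shows "imbalance_set (with_proj D) \<subseteq> {0}"
proof -
  have "finite (pverts D)"
    using assms(1) unfolding tournament_iff by blast
  then have "\<forall>v \<in> pverts D. - imbalance (with_proj D) v = 0"
    using sum_imbalance_eq_0[OF assms(1)] assms(2)
    by (subst sum_nonneg_eq_0_iff[symmetric]) (auto simp: imbalance_set_def sum_negf)
  then show ?thesis
    by (auto simp: imbalance_set_def)
qed

end

theory Submission
  imports Defs
begin

text \<open>
  An integer sequence \<open>b\<close> of the right parity with sum zero is realised by a tournament on \<open>V\<close> as soon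
  as \<open>\<Sum>\<^sub>S b \<ge> - |S| |V - S|\<close> for all \<open>S \<subseteq> V\<close> (Landau): in a tournament whose imbalances are
  closest to \<open>b\<close>, a path from a vertex with too large an imbalance to one with too small an imbalance
  could be reversed, and otherwise the vertices reachable from the former violate the inequality.
  The inequality is automatic once \<open>|V| \<ge> 2 max |b|\<close>. So it suffices to find a zero-sum list of
  odd length with set of entries \<open>X \<union> Y\<close>, and to repeat it often enough. The blocks consisting of
  \<open>c\<close> copies of \<open>a \<in> X\<close> and \<open>a\<close> copies of \<open>- c \<in> Y\<close> have sum zero and even length and together
  contain all of \<open>X \<union> Y\<close>; each of the three conditions supplies a zero-sum list of odd length.
\<close>

section \<open>Landau's criterion\<close>

lemma imbalance_eq_sum:
  assumes "finite (pverts T)" "parcs T \<subseteq> pverts T \<times> pverts T"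
  shows "imbalance (with_proj T) v =
    (\<Sum>w \<in> pverts T. of_bool ((v, w) \<in> parcs T) - of_bool ((w, v) \<in> parcs T))"
proof -
  have out: "{e \<in> parcs T. fst e = v} = Pair v ` {w \<in> pverts T. (v, w) \<in> parcs T}"
    and "in": "{e \<in> parcs T. snd e = v} = (\<lambda>w. (w, v)) ` {w \<in> pverts T. (w, v) \<in> parcs T}"
    using assms(2) by auto
  have "card {e \<in> parcs T. fst e = v} = card {w \<in> pverts T. (v, w) \<in> parcs T}"
    "card {e \<in> parcs T. snd e = v} = card {w \<in> pverts T. (w, v) \<in> parcs T}"
    unfolding out "in" by (auto intro!: card_image inj_onI)
  then show ?thesis
    using assms(1)
    by (simp add: imbalance_def out_degree_def in_degree_def out_arcs_def in_arcs_def
        sum_subtractf sum_of_bool_eq Int_def)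
qed

lemma
  assumes "tournament T"
  shows tournament_finite: "finite (pverts T)"
    and tournament_arcs: "parcs T \<subseteq> pverts T \<times> pverts T"
    and tournament_irrefl: "(u, u) \<notin> parcs T"
    and tournament_asym: "(u, v) \<in> parcs T \<Longrightarrow> (v, u) \<notin> parcs T"
    and tournament_total:
      "u \<in> pverts T \<Longrightarrow> v \<in> pverts T \<Longrightarrow> u \<noteq> v \<Longrightarrow> (u, v) \<notin> parcs T \<Longrightarrow> (v, u) \<in> parcs T"
  using assms unfolding tournament_iff by blast+

lemma tournament_imbalance:
  assumes "tournament T"
  shows "imbalance (with_proj T) v =
    (\<Sum>w \<in> pverts T. of_bool ((v, w) \<in> parcs T) - of_bool ((w, v) \<in> parcs T))"
  by (rule imbalance_eq_sum[OF tournament_finite[OF assms] tournament_arcs[OF assms]])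

text \<open>Each of the other \<open>card (pverts T) - 1\<close> vertices contributes 1 or -1 to the
  imbalance of \<open>v\<close>. Hence even imbalances force an odd number of vertices.\<close>

lemma even_imbalance:
  assumes T: "tournament T" and v: "v \<in> pverts T"
  shows "even (imbalance (with_proj T) v + int (card (pverts T)) + 1)"
proof -
  let ?f = "\<lambda>w. of_bool ((v, w) \<in> parcs T) - of_bool ((w, v) \<in> parcs T) :: int"
  have fin: "finite (pverts T)" by (rule tournament_finite[OF T])
  have "even (?f w + 1)" if "w \<in> pverts T - {v}" for w
    using that v tournament_asym[OF T, of v w] tournament_total[OF T, of v w] by auto
  then have "even (\<Sum>w \<in> pverts T - {v}. ?f w + 1)"
    by (intro dvd_sum) auto
  moreover have "(\<Sum>w \<in> pverts T - {v}. ?f w + 1) = imbalance (with_proj T) v + int (card (pverts T)) - 1"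
  proof -
    have "imbalance (with_proj T) v = (\<Sum>w \<in> pverts T - {v}. ?f w)"
      unfolding tournament_imbalance[OF T] using v fin by (simp add: sum.remove)
    moreover have "0 < card (pverts T)"
      using v fin by (auto simp: card_gt_0_iff)
    ultimately show ?thesis
      using v fin by (simp add: sum.distrib of_nat_diff)
  qed
  ultimately show ?thesis by simp
qed

section \<open>Reversal of arcs and paths\<close>

lemma reverse_arc:
  assumes T: "tournament T" and arc: "(u, w) \<in> parcs T"
  defines "T' \<equiv> T\<lparr>parcs := insert (w, u) (parcs T - {(u, w)})\<rparr>"
  shows "tournament T'"
    and "imbalance (with_proj T') v =
      imbalance (with_proj T) v - 2 * of_bool (v = u) + 2 * of_bool (v = w)"
proof -
  have uw: "u \<in> pverts T" "w \<in> pverts T" "u \<noteq> w" "(w, u) \<notin> parcs T"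
    using tournament_arcs[OF T] tournament_irrefl[OF T] tournament_asym[OF T] arc by auto
  show T': "tournament T'"
    unfolding tournament_iff
  proof (intro conjI ballI impI)
    show "finite (pverts T')" using tournament_finite[OF T] by (simp add: T'_def)
    show "parcs T' \<subseteq> {(u, v). u \<in> pverts T' \<and> v \<in> pverts T' \<and> u \<noteq> v}"
      using T uw unfolding tournament_iff T'_def by fastforce
    show "(a, b) \<in> parcs T' \<longleftrightarrow> (b, a) \<notin> parcs T'"
      if "a \<in> pverts T'" "b \<in> pverts T'" "a \<noteq> b" for a b
      using that uw(3) tournament_asym[OF T, of a b] tournament_total[OF T, of a b]
      by (cases "(a, b) = (u, w) \<or> (a, b) = (w, u)") (auto simp: T'_def)
  qed
  have fin: "finite (pverts T)" by (rule tournament_finite[OF T])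
  let ?f = "\<lambda>A z. of_bool ((v, z) \<in> A) - of_bool ((z, v) \<in> A) :: int"
  \<comment> \<open>Only two terms change: the one for \<open>w\<close> in the sum at
    \<open>u\<close> drops from 1 to -1, and the one for \<open>u\<close> in the sum at
    \<open>w\<close> rises from -1 to 1.\<close>
  have "?f (parcs T') z = ?f (parcs T) z - (if z = w then 2 * of_bool (v = u) else 0)
      + (if z = u then 2 * of_bool (v = w) else 0)" for z
    using uw arc by (cases "v = u"; cases "v = w"; cases "z = u"; cases "z = w") (simp_all add: T'_def)
  then have "imbalance (with_proj T') v = (\<Sum>z \<in> pverts T. ?f (parcs T) z
      - (if z = w then 2 * of_bool (v = u) else 0) + (if z = u then 2 * of_bool (v = w) else 0))"
    unfolding tournament_imbalance[OF T'] by (simp add: T'_def)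
  also have "\<dots> = imbalance (with_proj T) v - 2 * of_bool (v = u) + 2 * of_bool (v = w)"
    unfolding tournament_imbalance[OF T] using fin uw
    by (simp add: sum.distrib sum_subtractf)
  finally show "imbalance (with_proj T') v =
      imbalance (with_proj T) v - 2 * of_bool (v = u) + 2 * of_bool (v = w)" .
qed

text \<open>The path is extended at its front; if the new start already lies on it, the suffix from
  that occurrence is taken instead.\<close>

lemma rtrancl_distinct_path:
  assumes "(u, v) \<in> A\<^sup>*"
  shows "\<exists>p. distinct (u # p) \<and> successively (\<lambda>a b. (a, b) \<in> A) (u # p) \<and> last (u # p) = v"
  using assms
proof (induction rule: converse_rtrancl_induct)
  case base
  show ?case by (rule exI[of _ "[]"]) simp
next
  case (step u w)
  then obtain p where p: "distinct (w # p)" "successively (\<lambda>a b. (a, b) \<in> A) (w # p)"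
    "last (w # p) = v" by blast
  show ?case
  proof (cases "u \<in> set (w # p)")
    case True
    then obtain q r where qr: "w # p = q @ u # r"
      by (meson split_list)
    with p have "distinct (u # r)" "last (u # r) = v" "successively (\<lambda>a b. (a, b) \<in> A) (u # r)"
      by (auto simp: successively_append_iff simp del: last.simps successively.simps)
    then show ?thesis by blast
  next
    case False
    with p step(1) show ?thesis
      by (intro exI[of _ "w # p"]) auto
  qed
qed

text \<open>The arcs are reversed one by one from the front. An inner vertex gains 2 from one
  reversal and loses 2 in the next, so only the two ends change.\<close>

lemma reverse_path:
  assumes "tournament T" "successively (\<lambda>a b. (a, b) \<in> parcs T) (u # p)" "distinct (u # p)"
  shows "\<exists>T'. tournament T' \<and> pverts T' = pverts T \<and>
    (\<forall>v. imbalance (with_proj T') v =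
      imbalance (with_proj T) v - 2 * of_bool (v = u) + 2 * of_bool (v = last (u # p)))"
  using assms
proof (induction p arbitrary: u T)
  case Nil
  then show ?case by (intro exI[of _ T]) auto
next
  case (Cons w p)
  define T1 where "T1 = T\<lparr>parcs := insert (w, u) (parcs T - {(u, w)})\<rparr>"
  have arc: "(u, w) \<in> parcs T" using Cons.prems by simp
  note T1 = reverse_arc[OF Cons.prems(1) arc, folded T1_def]
  \<comment> \<open>By distinctness \<open>u\<close> is not on the remaining path, so that path
    avoids the arc \<open>(u, w)\<close> and survives its reversal.\<close>
  have "successively (\<lambda>a b. (a, b) \<in> parcs T1) (w # p)"
    by (rule successively_mono[of "\<lambda>a b. (a, b) \<in> parcs T"]) (use Cons.prems in \<open>auto simp: T1_def\<close>)
  from Cons.IH[OF T1(1) this] Cons.prems(3) obtain T' where T': "tournament T'" "pverts T' = pverts T1"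
    "\<And>v. imbalance (with_proj T') v =
      imbalance (with_proj T1) v - 2 * of_bool (v = w) + 2 * of_bool (v = last (w # p))"
    by auto
  then show ?case
    by (intro exI[of _ T']) (simp add: T1(2), simp add: T1_def)
qed

text \<open>Arcs inside \<open>R\<close> cancel, and each pair between \<open>R\<close> and its
  complement is an arc into \<open>R\<close>, contributing -1. This is equality in the Landau
  inequality.\<close>

lemma sum_imbalance_closed:
  assumes T: "tournament T" and R: "R \<subseteq> pverts T"
    and closed: "\<And>u v. u \<in> R \<Longrightarrow> (u, v) \<in> parcs T \<Longrightarrow> v \<in> R"
  shows "(\<Sum>v \<in> R. imbalance (with_proj T) v) = - int (card R) * int (card (pverts T - R))"
proof -
  let ?a = "\<lambda>v w. of_bool ((v, w) \<in> parcs T) :: int"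
  have fin: "finite (pverts T)" by (rule tournament_finite[OF T])
  have "imbalance (with_proj T) v = (\<Sum>w \<in> R. ?a v w - ?a w v) - int (card (pverts T - R))"
    if v: "v \<in> R" for v
  proof -
    have "(\<Sum>w \<in> pverts T - R. ?a v w - ?a w v) = (\<Sum>w \<in> pverts T - R. -1)"
    proof (rule sum.cong[OF refl])
      fix w assume w: "w \<in> pverts T - R"
      then have "(v, w) \<notin> parcs T" "v \<noteq> w" using v closed by auto
      then show "?a v w - ?a w v = -1"
        using tournament_total[OF T, of v w] v w R by auto
    qed
    then show ?thesis
      unfolding tournament_imbalance[OF T] using sum.subset_diff[OF R fin, of "\<lambda>w. ?a v w - ?a w v"] by simp
  qed
  moreover have "(\<Sum>v \<in> R. \<Sum>w \<in> R. ?a v w - ?a w v) = 0"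
    using sum.swap[of "\<lambda>v w. ?a w v" R R] by (simp add: sum_subtractf)
  ultimately show ?thesis by (simp add: sum_subtractf)
qed

section \<open>Realisation of prescribed imbalances\<close>

lemma ex_tournament:
  assumes "finite (V :: 'a :: linorder set)"
  shows "\<exists>T. tournament T \<and> pverts T = V"
  by (rule exI[of _ "\<lparr>pverts = V, parcs = {(u, v). u \<in> V \<and> v \<in> V \<and> u < v}\<rparr>"])
    (use assms in \<open>auto simp: tournament_iff\<close>)

text \<open>In terms of the scores \<open>(b v + card V - 1) / 2\<close>, the inequality says that
  the scores in \<open>S\<close> sum to at least \<open>card S\<close> choose 2, which is Landau's
  condition.\<close>

theorem landau:
  fixes V :: "'a :: linorder set" and b :: "'a \<Rightarrow> int"
  assumes fin: "finite V"
    and parity: "\<And>v. v \<in> V \<Longrightarrow> even (b v + int (card V) + 1)"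
    and sum0: "(\<Sum>v \<in> V. b v) = 0"
    and landau: "\<And>S. S \<subseteq> V \<Longrightarrow> - int (card S) * int (card (V - S)) \<le> (\<Sum>v \<in> S. b v)"
  shows "\<exists>T. tournament T \<and> pverts T = V \<and> (\<forall>v \<in> V. imbalance (with_proj T) v = b v)"
proof -
  define d where "d = (\<lambda>T v. imbalance (with_proj T) v - b v)"
  define dist where "dist = (\<lambda>T. \<Sum>v \<in> V. \<bar>d T v\<bar>)"
  obtain T where T: "tournament T" "pverts T = V"
    and min: "\<And>T'. tournament T' \<Longrightarrow> pverts T' = V \<Longrightarrow> nat (dist T) \<le> nat (dist T')"
    using ex_tournament[OF fin]
      ex_has_least_nat[of "\<lambda>T. tournament T \<and> pverts T = V" _ "\<lambda>T. nat (dist T)"] by metis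
  have "\<forall>v \<in> V. d T v = 0"
  proof (rule ccontr)
    assume not0: "\<not> ?thesis"
    have sumd: "(\<Sum>v \<in> V. d T v) = 0"
      using sum_imbalance_eq_0[OF T(1)] sum0 T(2) by (simp add: d_def sum_subtractf)
    have "\<exists>u \<in> V. 0 < d T u"
    proof (rule ccontr)
      assume "\<not> ?thesis"
      then have "\<forall>v \<in> V. d T v \<le> 0" by force
      with sumd have "\<forall>v \<in> V. - d T v = 0"
        by (subst sum_nonneg_eq_0_iff[OF fin, symmetric]) (auto simp: sum_negf)
      with not0 show False by auto
    qed
    then obtain u where u: "u \<in> V" "0 < d T u" by blast
    define R where "R = {v. (u, v) \<in> (parcs T)\<^sup>*}"
    have RV: "R \<subseteq> V"
    proof
      fix v assume "v \<in> R"
      then have "(u, v) \<in> (parcs T)\<^sup>*" by (simp add: R_def)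
      then show "v \<in> V"
        by (cases rule: rtranclE) (use u tournament_arcs[OF T(1)] T(2) in auto)
    qed
    \<comment> \<open>Both imbalances and targets have the parity of \<open>card V + 1\<close>, so a
      nonzero defect has absolute value at least 2.\<close>
    have evend: "even (d T v)" if "v \<in> V" for v
      using even_imbalance[OF T(1), of v] parity[OF that] that T(2) by (simp add: d_def)
    have nonneg: "0 \<le> d T v" if v: "v \<in> R" for v
    proof (rule ccontr)
      assume neg: "\<not> 0 \<le> d T v"
      have vV: "v \<in> V" and uv: "u \<noteq> v" using RV v neg u(2) by auto
      from v obtain p where "distinct (u # p)" "last (u # p) = v"
        "successively (\<lambda>a b. (a, b) \<in> parcs T) (u # p)"
        unfolding R_def using rtrancl_distinct_path[of u v "parcs T"] by auto
      with reverse_path[OF T(1)] obtain T' where T': "tournament T'" "pverts T' = pverts T"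
        and imb: "\<And>w. imbalance (with_proj T') w =
          imbalance (with_proj T) w - 2 * of_bool (w = u) + 2 * of_bool (w = v)"
        by metis
      have d': "d T' w = d T w - 2 * of_bool (w = u) + 2 * of_bool (w = v)" for w
        by (simp add: d_def imb)
      \<comment> \<open>Here \<open>d T u\<close> is at least 2 and \<open>d T v\<close> at most -2,
        so a shift by 2 moves both towards 0 without crossing it.\<close>
      have "\<bar>d T' w\<bar> \<le> \<bar>d T w\<bar>" "w = u \<Longrightarrow> \<bar>d T' w\<bar> < \<bar>d T w\<bar>" if "w \<in> V" for w
        using uv u(2) neg evend[OF u(1)] evend[OF vV] by (auto simp: d' elim!: evenE)
      then have "dist T' < dist T"
        unfolding dist_def using u(1) by (intro sum_strict_mono_ex1[OF fin]) auto
      moreover have "0 \<le> dist T'" by (simp add: dist_def sum_nonneg)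
      ultimately show False using min[OF T'(1)] T'(2) T(2) by simp
    qed
    have "finite R" using RV fin finite_subset by blast
    moreover have "u \<in> R" by (simp add: R_def)
    ultimately have "0 < (\<Sum>v \<in> R. d T v)"
      using nonneg u(2) by (intro sum_pos2[of R u]) auto
    \<comment> \<open>The imbalances on \<open>R\<close> attain the Landau bound; as the defects
      there have positive sum, the sum of \<open>b\<close> over \<open>R\<close> falls strictly
      below it.\<close>
    moreover have "(\<Sum>v \<in> R. imbalance (with_proj T) v) = - int (card R) * int (card (V - R))"
      using sum_imbalance_closed[OF T(1), of R] RV T(2)
      by (auto simp: R_def intro: rtrancl_into_rtrancl)
    ultimately show False
      using landau[OF RV] by (simp add: d_def sum_subtractf)
  qed
  with T show ?thesis by (auto simp: d_def)
qed

text \<open>At least one of \<open>S\<close> and \<open>V - S\<close> has \<open>M\<close> or more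
  elements. If it is \<open>V - S\<close>, the entrywise bound on \<open>S\<close> suffices; if it
  is \<open>S\<close>, the bound is applied to \<open>V - S\<close>, whose sum is the negative of
  that over \<open>S\<close>.\<close>

lemma landau_condition_bounded:
  fixes b :: "'a \<Rightarrow> int"
  assumes fin: "finite V" and sum0: "(\<Sum>v \<in> V. b v) = 0"
    and bound: "\<And>v. v \<in> V \<Longrightarrow> \<bar>b v\<bar> \<le> M" and large: "2 * M \<le> int (card V)" and S: "S \<subseteq> V"
  shows "- int (card S) * int (card (V - S)) \<le> (\<Sum>v \<in> S. b v)"
proof -
  have low: "- (int (card R) * M) \<le> (\<Sum>v \<in> R. b v)" "(\<Sum>v \<in> R. b v) \<le> int (card R) * M"
    if "R \<subseteq> V" for R
  proof -
    have "(\<Sum>v \<in> R. \<bar>b v\<bar>) \<le> int (card R) * M"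
      using sum_bounded_above[of R "\<lambda>v. \<bar>b v\<bar>" M] bound that by auto
    then show "- (int (card R) * M) \<le> (\<Sum>v \<in> R. b v)" "(\<Sum>v \<in> R. b v) \<le> int (card R) * M"
      using sum_abs[of b R] by linarith+
  qed
  have card: "card V = card S + card (V - S)"
    using fin S by (metis card_Diff_subset card_mono finite_subset le_add_diff_inverse)
  consider "M \<le> int (card (V - S))" | "M \<le> int (card S)"
    using large card by linarith
  then show ?thesis
  proof cases
    case 1
    then have "int (card S) * M \<le> int (card S) * int (card (V - S))"
      by (intro mult_left_mono) auto
    with low(1)[OF S] show ?thesis by simp
  next
    case 2
    then have "int (card (V - S)) * M \<le> int (card (V - S)) * int (card S)"
      by (intro mult_left_mono) auto
    moreover have "(\<Sum>v \<in> S. b v) = - (\<Sum>v \<in> V - S. b v)"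
      using sum.subset_diff[OF S fin, of b] sum0 by simp
    ultimately show ?thesis using low(2)[of "V - S"] by (simp add: mult.commute)
  qed
qed

section \<open>Zero-sum lists of odd length\<close>

lemma sum_list_concat_replicate: "sum_list (concat (replicate k xs)) = of_nat k * sum_list xs"
  for xs :: "'a :: semiring_1 list"
  by (induction k) (auto simp: algebra_simps)

lemma length_concat_replicate: "length (concat (replicate k xs)) = k * length xs"
  by (induction k) auto

lemma imbalance_set_of_zero_sum_list:
  fixes L :: "int list"
  assumes ev: "\<forall>a \<in> set L. even a" and sum0: "sum_list L = 0" and odd: "odd (length L)"
  shows "\<exists>T :: nat pair_pre_digraph. tournament T \<and> imbalance_set (with_proj T) = set L"
proof -
  define M where "M = nat (\<Sum>a \<leftarrow> L. \<bar>a\<bar>)"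
  have M: "\<bar>a\<bar> \<le> int M" if "a \<in> set L" for a
  proof -
    have "\<bar>a\<bar> \<le> (\<Sum>a \<leftarrow> L. \<bar>a\<bar>)"
      by (rule member_le_sum_list) (use that in auto)
    then show ?thesis unfolding M_def by linarith
  qed
  \<comment> \<open>An odd number of copies keeps the length odd, and \<open>2 * M + 1\<close>
    copies give enough vertices for the bound \<open>M\<close>. The vertices are list positions, so
    values may repeat.\<close>
  define L' where "L' = concat (replicate (2 * M + 1) L)"
  have set: "set L' = set L" by (auto simp: L'_def)
  have len: "length L' = (2 * M + 1) * length L"
    unfolding L'_def by (rule length_concat_replicate)
  have "0 < length L" using odd by (cases L) auto
  then have "2 * M \<le> length L'" unfolding len by (cases "length L") auto
  then have large: "2 * int M \<le> int (card {..<length L'})" by simp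
  have "sum_list L' = 0" unfolding L'_def sum_list_concat_replicate sum0 by simp
  then have sum0': "(\<Sum>i \<in> {..<length L'}. L' ! i) = 0"
    by (simp add: sum_list_sum_nth atLeast0LessThan)
  have mem: "L' ! i \<in> set L" if "i \<in> {..<length L'}" for i
    using that set nth_mem by blast
  have "\<exists>T. tournament T \<and> pverts T = {..<length L'} \<and>
      (\<forall>i \<in> {..<length L'}. imbalance (with_proj T) i = L' ! i)"
  proof (rule landau)
    show "even (L' ! i + int (card {..<length L'}) + 1)" if "i \<in> {..<length L'}" for i
      using ev mem[OF that] odd by (simp add: len)
    show "- int (card S) * int (card ({..<length L'} - S)) \<le> (\<Sum>i \<in> S. L' ! i)"
      if "S \<subseteq> {..<length L'}" for S
      by (rule landau_condition_bounded[OF _ sum0' M[OF mem] large that]) auto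
  qed (use sum0' in auto)
  then obtain T where T: "tournament T" "pverts T = {..<length L'}"
    "\<forall>i \<in> {..<length L'}. imbalance (with_proj T) i = L' ! i" by blast
  then have "imbalance_set (with_proj T) = (\<lambda>i. L' ! i) ` {..<length L'}"
    by (simp add: imbalance_set_def)
  also have "\<dots> = set L" using set by (auto simp: set_conv_nth)
  finally show ?thesis using T(1) by blast
qed

lemma zero_sum_list_even_length:
  fixes X Y :: "int set"
  assumes "finite X" "finite Y"
    and X: "\<And>a. a \<in> X \<Longrightarrow> 0 \<le> a \<and> even a" and Y: "\<And>c. c \<in> Y \<Longrightarrow> c < 0 \<and> even c"
    and pos: "\<exists>a \<in> X. 0 < a" and ne: "Y \<noteq> {}"
  shows "\<exists>L. set L = X \<union> Y \<and> sum_list L = 0 \<and> even (length L)"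
proof -
  define block where "block = (\<lambda>(a, c). replicate (nat (- c)) a @ replicate (nat a) c)"
  obtain ps where ps: "set ps = X \<times> Y"
    using assms(1,2) finite_list[of "X \<times> Y"] by auto
  define L where "L = concat (map block ps)"
  have block: "set (block p) \<subseteq> X \<union> Y \<and> sum_list (block p) = 0 \<and> even (length (block p))"
    if "p \<in> X \<times> Y" for p
    using that X Y by (force simp: block_def sum_list_replicate even_nat_iff)
  have "sum_list (concat (map block qs)) = 0 \<and> even (length (concat (map block qs)))"
    if "set qs \<subseteq> X \<times> Y" for qs
    using that by (induction qs) (use block in auto)
  from this[of ps] have "sum_list L = 0" "even (length L)" by (simp_all add: ps L_def)
  moreover have "set L = X \<union> Y"
  proof
    show "set L \<subseteq> X \<union> Y" using block ps by (force simp: L_def)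
    \<comment> \<open>The block of \<open>(a, c)\<close> contains \<open>a\<close> even for
      \<open>a = 0\<close>, since \<open>- c\<close> is positive, but contains \<open>c\<close> only
      for positive \<open>a\<close>; hence \<open>a0\<close>.\<close>
    obtain a0 where a0: "a0 \<in> X" "0 < a0" using pos by blast
    obtain c0 where c0: "c0 \<in> Y" using ne by blast
    have "a \<in> set (block (a, c0))" if "a \<in> X" for a
      using Y[OF c0] by (simp add: block_def)
    moreover have "c \<in> set (block (a0, c))" if "c \<in> Y" for c
      using a0 by (simp add: block_def)
    ultimately show "X \<union> Y \<subseteq> set L"
      using a0 c0 ps by (force simp: L_def)
  qed
  ultimately show ?thesis by blast
qed

text \<open>This serves both sum conditions: elements of \<open>Y\<close> enter with their negative
  sign, so equal sums become total zero, and the length \<open>(2 * r + 1) + 2 * s\<close> is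
  odd.\<close>

lemma zero_sum_list_of_equal_sums:
  fixes f g :: "nat \<Rightarrow> int"
  assumes "\<And>j. j \<in> {1..2 * r + 1} \<Longrightarrow> f j \<in> A" "\<And>j. j \<in> {1..2 * s} \<Longrightarrow> g j \<in> A"
    and "(\<Sum>j = 1..2 * r + 1. f j) + (\<Sum>j = 1..2 * s. g j) = 0"
  shows "\<exists>C. set C \<subseteq> A \<and> sum_list C = 0 \<and> odd (length C)"
proof -
  have eq: "sum_list (map h [1..<Suc n]) = (\<Sum>j = 1..n. h j)" for h :: "nat \<Rightarrow> int" and n
    by (simp only: interv_sum_list_conv_sum_set_nat set_upt atLeastLessThanSuc_atLeastAtMost)
  show ?thesis
    by (rule exI[of _ "map f [1..<Suc (2 * r + 1)] @ map g [1..<Suc (2 * s)]"])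
      (use assms in \<open>auto simp only: sum_list_append eq set_append set_map length_append
        length_map length_upt set_upt atLeastLessThanSuc_atLeastAtMost; simp\<close>)
qed

section \<open>From the three conditions to a tournament\<close>

theorem theorem3p4:
  fixes X Y :: "int set" and x y :: "nat \<Rightarrow> int" and l m :: nat
  assumes X_eq: "X = x ` {1..l}"
    and Y_eq: "Y = (\<lambda>i. - y i) ` {1..m}"
    and disj: "X \<inter> Y = {}"
    and nonempty: "X \<noteq> {}" "Y \<noteq> {}"
    and x_decr: "strict_antimono_on {1..l} x"
    and y_incr: "strict_mono_on {1..m} y"
    and x_val: "\<And>i. i \<in> {1..l} \<Longrightarrow> 0 \<le> x i \<and> even (x i)"
    and y_val: "\<And>i. i \<in> {1..m} \<Longrightarrow> 0 < y i \<and> even (y i)"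
    and not_zero: "X \<union> Y \<noteq> {0}"
    and X_not_zero: "X \<noteq> {0}"
    and cond:
      "0 \<in> X \<union> Y \<or>
       (\<exists>(r :: nat) (s :: nat) (p :: nat \<Rightarrow> nat) (q :: nat \<Rightarrow> nat).
          (\<forall>j \<in> {1..2 * r + 1}. p j \<in> {1..l}) \<and> (\<forall>j \<in> {1..2 * s}. q j \<in> {1..m}) \<and>
          (\<Sum>j = 1..2 * r + 1. x (p j)) = (\<Sum>j = 1..2 * s. y (q j))) \<or>
       (\<exists>(r :: nat) (s :: nat) (p :: nat \<Rightarrow> nat) (q :: nat \<Rightarrow> nat).
          (\<forall>j \<in> {1..2 * r + 1}. p j \<in> {1..m}) \<and> (\<forall>j \<in> {1..2 * s}. q j \<in> {1..l}) \<and>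
          (\<Sum>j = 1..2 * r + 1. y (p j)) = (\<Sum>j = 1..2 * s. x (q j)))"
  shows "\<exists>T :: nat pair_pre_digraph. tournament T \<and> imbalance_set (with_proj T) = X \<union> Y"
proof -
  have "\<exists>C. set C \<subseteq> X \<union> Y \<and> sum_list C = 0 \<and> odd (length C)"
    using cond
  proof (elim disjE exE conjE)
    assume "0 \<in> X \<union> Y"
    then show ?thesis by (intro exI[of _ "[0]"]) auto
  next
    fix r s :: nat and p q :: "nat \<Rightarrow> nat"
    assume "\<forall>j \<in> {1..2 * r + 1}. p j \<in> {1..l}" "\<forall>j \<in> {1..2 * s}. q j \<in> {1..m}"
      "(\<Sum>j = 1..2 * r + 1. x (p j)) = (\<Sum>j = 1..2 * s. y (q j))"
    then show ?thesis
      by (intro zero_sum_list_of_equal_sums[of r "\<lambda>j. x (p j)" _ s "\<lambda>j. - y (q j)"])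
        (auto simp: X_eq Y_eq sum_negf)
  next
    fix r s :: nat and p q :: "nat \<Rightarrow> nat"
    assume "\<forall>j \<in> {1..2 * r + 1}. p j \<in> {1..m}" "\<forall>j \<in> {1..2 * s}. q j \<in> {1..l}"
      "(\<Sum>j = 1..2 * r + 1. y (p j)) = (\<Sum>j = 1..2 * s. x (q j))"
    then show ?thesis
      by (intro zero_sum_list_of_equal_sums[of r "\<lambda>j. - y (p j)" _ s "\<lambda>j. x (q j)"])
        (auto simp: X_eq Y_eq sum_negf)
  qed
  then obtain C where C: "set C \<subseteq> X \<union> Y" "sum_list C = 0" "odd (length C)" by blast
  have X: "0 \<le> a \<and> even a" if "a \<in> X" for a using that x_val by (auto simp: X_eq)
  have Y: "c < 0 \<and> even c" if "c \<in> Y" for c using that y_val by (auto simp: Y_eq)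
  \<comment> \<open>A nonempty set of non-negative integers without a positive element would be
    \<open>{0}\<close>.\<close>
  have "\<exists>a \<in> X. 0 < a"
    using nonempty(1) X_not_zero X by (metis is_singletonI' is_singleton_the_elem
        insertI1 order_le_less)
  then obtain B where B: "set B = X \<union> Y" "sum_list B = 0" "even (length B)"
    using zero_sum_list_even_length[of X Y] X Y nonempty(2) by (auto simp: X_eq Y_eq)
  \<comment> \<open>\<open>B\<close> supplies every required value, while \<open>C\<close> makes the
    total length odd without adding new values.\<close>
  have "set (B @ C) = X \<union> Y" using B C by auto
  moreover have "\<exists>T :: nat pair_pre_digraph. tournament T \<and> imbalance_set (with_proj T) = set (B @ C)"
    using B C X Y by (intro imbalance_set_of_zero_sum_list) auto
  ultimately show ?thesis by simp
qed

end
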